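(* Let $G$ and $H$ be countable groups and let $f:G\to H$ be a quasimorphism with defect set $D(f)$. Then $$\operatorname{asdim}G\;\leq\;\operatorname{asdim}H+\operatorname{asdim}\left(f^{-1}\left(f(e_G)\,D(f)^{-1}D(f)\right)\right),$$ where $e_G$ is the identity of $G$.
   Context: Notation: for subsets $A,B$ of a group, $AB=\{ab\mid a\in A,b\in B\}$, $A^{-1}=\{a^{-1}\mid a\in A\}$, $gA=\{ga\mid a\in A\}$. A function $f:G\to H$ between groups is a quasimorphism if its defect set $D(f)=\{f(y)^{-1}f(x)^{-1}f(xy)\mid x,y\in G\}$ is finite. Here $f^{-1}(\cdot)$ applied to a subset of $H$ denotes the preimage under $f$, a subset of $G$. Asymptotic dimension of a metric space: for an integer $n\geq 0$, a metric space $(X,d)$ satisfies $\operatorname{asdim}X\leq n$ if for every $r>0$ there is a cover $\mathcal U=\bigcup_{i=1}^{n+1}\mathcal U_i$ of $X$ such that for each $i$ any two different $U,U'\in\mathcal U_i$ satisfy $d(U,U')\geq r$ (with $d(U,U')=\inf\{d(u,u')\mid u\in U,u'\in U'\}$), and there is $D>0$ with $\operatorname{diam}U\leq D$ for all $U\in\mathcal U$. $\operatorname{asdim}X$ is the smallest such $n$, or $\infty$ if there is none. Asymptotic dimension of subsets of a countable group: every countable group $G$ admits a left-invariant proper metric compatible with the discrete topology (proper: closed balls are compact, so here all balls are finite). For $A\subseteq G$ (for instance $A=G$), $\operatorname{asdim}A:=\operatorname{asdim}(A,d|_{A\times A})$ for any left-invariant proper metric $d$ on $G$; this does not depend on the choice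 of $d$. *)

theory Defs
  imports "HOL-Analysis.Analysis" "HOL-Algebra.Coset"
begin

context Metric_space
begin

text \<open>Extended-real values: the infimum over an empty set is \<open>\<infinity>\<close>, and the supremum over an
  unbounded set is \<open>\<infinity>\<close>.\<close>

definition set_gap :: "'a set \<Rightarrow> 'a set \<Rightarrow> ereal" where
  "set_gap U V = (INF (u, v) \<in> U \<times> V. ereal (d u v))"

definition set_diam :: "'a set \<Rightarrow> ereal" where
  "set_diam U = (SUP (u, v) \<in> U \<times> U. ereal (d u v))"

text \<open>The \<open>n + 1\<close> families are indexed by \<open>0, \<dots>, n\<close>.\<close>

definition asdim_le :: "nat \<Rightarrow> bool" where
  "asdim_le n \<longleftrightarrow>
     (\<forall>r::real. r > 0 \<longrightarrow>
       (\<exists>\<U> :: nat \<Rightarrow> 'a set set.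
          (\<Union>i\<le>n. \<Union>(\<U> i)) = M \<and>
          (\<forall>i\<le>n. \<forall>U\<in>\<U> i. \<forall>V\<in>\<U> i. U \<noteq> V \<longrightarrow> set_gap U V \<ge> ereal r) \<and>
          (\<exists>D::real. D > 0 \<and> (\<forall>i\<le>n. \<forall>U\<in>\<U> i. set_diam U \<le> ereal D))))"

text \<open>In \<^typ>\<open>enat\<close>, the infimum of the empty set is \<open>\<infinity>\<close>.\<close>

definition asdim :: enat where
  "asdim = Inf {enat n |n. asdim_le n}"

lemma set_gap_ge_iff: "set_gap U V \<ge> ereal r \<longleftrightarrow> (\<forall>u\<in>U. \<forall>v\<in>V. d u v \<ge> r)"
  by (auto simp: set_gap_def le_INF_iff)

lemma set_diam_le_iff: "set_diam U \<le> ereal D \<longleftrightarrow> (\<forall>u\<in>U. \<forall>v\<in>U. d u v \<le> D)"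
  by (auto simp: set_diam_def SUP_le_iff)

end

definition left_invariant_proper_metric ::
    "('a, 'm) monoid_scheme \<Rightarrow> ('a \<Rightarrow> 'a \<Rightarrow> real) \<Rightarrow> bool" where
  "left_invariant_proper_metric G d \<longleftrightarrow>
     Metric_space (carrier G) d \<and>
     Metric_space.mtopology (carrier G) d = discrete_topology (carrier G) \<and>
     (\<forall>g\<in>carrier G. \<forall>x\<in>carrier G. \<forall>y\<in>carrier G. d (g \<otimes>\<^bsub>G\<^esub> x) (g \<otimes>\<^bsub>G\<^esub> y) = d x y) \<and>
     (\<forall>x\<in>carrier G. \<forall>r. compactin (Metric_space.mtopology (carrier G) d)
                                   (Metric_space.mcball (carrier G) d x r))"

text \<open>The choice of metric is immaterial: see \<open>ex_left_invariant_proper_metric\<close> and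
  \<open>group_asdim_eq\<close> below.\<close>

definition group_asdim :: "('a, 'm) monoid_scheme \<Rightarrow> 'a set \<Rightarrow> enat" where
  "group_asdim G A = Metric_space.asdim A (SOME d. left_invariant_proper_metric G d)"

definition defect_set ::
    "('a, 'm) monoid_scheme \<Rightarrow> ('b, 'n) monoid_scheme \<Rightarrow> ('a \<Rightarrow> 'b) \<Rightarrow> 'b set" where
  "defect_set G H f =
     {inv\<^bsub>H\<^esub> (f y) \<otimes>\<^bsub>H\<^esub> inv\<^bsub>H\<^esub> (f x) \<otimes>\<^bsub>H\<^esub> f (x \<otimes>\<^bsub>G\<^esub> y) |x y. x \<in> carrier G \<and> y \<in> carrier G}"

definition quasimorphism ::
    "('a, 'm) monoid_scheme \<Rightarrow> ('b, 'n) monoid_scheme \<Rightarrow> ('a \<Rightarrow> 'b) \<Rightarrow> bool" where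
  "quasimorphism G H f \<longleftrightarrow> f \<in> carrier G \<rightarrow> carrier H \<and> finite (defect_set G H f)"

lemma left_invariant_proper_metric_finite_ball:
  assumes "left_invariant_proper_metric G d" "x \<in> carrier G"
  shows "finite {y \<in> carrier G. d x y \<le> r}"
proof -
  interpret Metric_space "carrier G" d
    using assms by (simp add: left_invariant_proper_metric_def)
  have "compactin (discrete_topology (carrier G)) (mcball x r)"
    using assms unfolding left_invariant_proper_metric_def by metis
  then have "finite (mcball x r)"
    by (simp add: compactin_discrete_topology)
  moreover have "mcball x r = {y \<in> carrier G. d x y \<le> r}"
    using assms(2) by (auto simp: mcball_def)
  ultimately show ?thesis by simp
qed

lemma left_invariant_proper_metric_coarse:
  assumes "group G" and 1: "left_invariant_proper_metric G d" and 2: "left_invariant_proper_metric G d'"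
  shows "\<exists>S>0. \<forall>x\<in>carrier G. \<forall>y\<in>carrier G. d x y \<le> r \<longrightarrow> d' x y < S"
proof -
  interpret group G by fact
  let ?B = "{y \<in> carrier G. d \<one>\<^bsub>G\<^esub> y \<le> r}"
  define S where "S = (\<Sum>y\<in>?B. \<bar>d' \<one>\<^bsub>G\<^esub> y\<bar>) + 1"
  have fin: "finite ?B"
    using left_invariant_proper_metric_finite_ball[OF 1, of "\<one>\<^bsub>G\<^esub>"] by simp
  have "S > 0" unfolding S_def by (smt (verit) sum_nonneg abs_ge_zero)
  moreover have "d' x y < S" if x: "x \<in> carrier G" and y: "y \<in> carrier G" and le: "d x y \<le> r" for x y
  proof -
    let ?z = "inv\<^bsub>G\<^esub> x \<otimes>\<^bsub>G\<^esub> y"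
    have inv: "d \<one>\<^bsub>G\<^esub> ?z = d x y" "d' \<one>\<^bsub>G\<^esub> ?z = d' x y"
      using 1 2 x y unfolding left_invariant_proper_metric_def
      by (metis inv_closed l_inv)+
    then have "?z \<in> ?B" using x y le by simp
    then have "\<bar>d' \<one>\<^bsub>G\<^esub> ?z\<bar> \<le> (\<Sum>y\<in>?B. \<bar>d' \<one>\<^bsub>G\<^esub> y\<bar>)"
      using fin by (intro member_le_sum) auto
    then show ?thesis using inv unfolding S_def by linarith
  qed
  ultimately show ?thesis by blast
qed

lemma asdim_le_transfer:
  assumes G: "group G" and 1: "left_invariant_proper_metric G d" and 2: "left_invariant_proper_metric G d'"
    and A: "A \<subseteq> carrier G" and le: "Metric_space.asdim_le A d n"
  shows "Metric_space.asdim_le A d' n"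
proof -
  interpret X: Metric_space A d
    using 1 A by (auto simp: left_invariant_proper_metric_def intro: Metric_space.subspace)
  interpret Y: Metric_space A d'
    using 2 A by (auto simp: left_invariant_proper_metric_def intro: Metric_space.subspace)
  show ?thesis unfolding Y.asdim_le_def
  proof (intro allI impI)
    fix r :: real assume "r > 0"
    obtain S where S: "S > 0" "\<And>x y. x \<in> A \<Longrightarrow> y \<in> A \<Longrightarrow> d' x y \<le> r \<Longrightarrow> d x y < S"
      using left_invariant_proper_metric_coarse[OF G 2 1, of r] A by blast
    obtain \<U> D where U: "(\<Union>i\<le>n. \<Union>(\<U> i)) = A"
        "\<And>i U V. i \<le> n \<Longrightarrow> U \<in> \<U> i \<Longrightarrow> V \<in> \<U> i \<Longrightarrow> U \<noteq> V \<Longrightarrow> X.set_gap U V \<ge> ereal S"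
        "\<And>i U. i \<le> n \<Longrightarrow> U \<in> \<U> i \<Longrightarrow> X.set_diam U \<le> ereal D"
      using le \<open>S > 0\<close> unfolding X.asdim_le_def by metis
    obtain T where T: "T > 0" "\<And>x y. x \<in> A \<Longrightarrow> y \<in> A \<Longrightarrow> d x y \<le> D \<Longrightarrow> d' x y < T"
      using left_invariant_proper_metric_coarse[OF G 1 2, of D] A by blast
    have sub: "\<And>i U. i \<le> n \<Longrightarrow> U \<in> \<U> i \<Longrightarrow> U \<subseteq> A" using U(1) by blast
    have "Y.set_gap U V \<ge> ereal r" if "i \<le> n" "U \<in> \<U> i" "V \<in> \<U> i" "U \<noteq> V" for i U V
      unfolding Y.set_gap_ge_iff
    proof (intro ballI)
      fix u v assume uv: "u \<in> U" "v \<in> V"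
      then have "d u v \<ge> S" using U(2)[OF that] X.set_gap_ge_iff by blast
      then show "d' u v \<ge> r"
        using S(2)[of u v] uv sub[OF that(1,2)] sub[OF that(1,3)] by fastforce
    qed
    moreover have "Y.set_diam U \<le> ereal T" if "i \<le> n" "U \<in> \<U> i" for i U
      unfolding Y.set_diam_le_iff
    proof (intro ballI)
      fix u v assume uv: "u \<in> U" "v \<in> U"
      then have "d u v \<le> D" using U(3)[OF that] X.set_diam_le_iff by blast
      then show "d' u v \<le> T"
        using T(2)[of u v] uv sub[OF that] by fastforce
    qed
    ultimately show "\<exists>\<U>. (\<Union>i\<le>n. \<Union>(\<U> i)) = A \<and>
          (\<forall>i\<le>n. \<forall>U\<in>\<U> i. \<forall>V\<in>\<U> i. U \<noteq> V \<longrightarrow> Y.set_gap U V \<ge> ereal r) \<and>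
          (\<exists>D::real. D > 0 \<and> (\<forall>i\<le>n. \<forall>U\<in>\<U> i. Y.set_diam U \<le> ereal D))"
      using U(1) T(1) by (intro exI[of _ \<U>] conjI exI[of _ T]) simp_all
  qed
qed

theorem group_asdim_eq:
  assumes "group G" and d: "left_invariant_proper_metric G d" and "A \<subseteq> carrier G"
  shows "group_asdim G A = Metric_space.asdim A d"
proof -
  let ?d = "SOME d. left_invariant_proper_metric G d"
  have d': "left_invariant_proper_metric G ?d" by (rule someI[of "left_invariant_proper_metric G" d, OF d])
  interpret X: Metric_space A d
    using d assms by (auto simp: left_invariant_proper_metric_def intro: Metric_space.subspace)
  interpret Y: Metric_space A ?d
    using d' assms by (auto simp: left_invariant_proper_metric_def intro: Metric_space.subspace)
  have "X.asdim_le n \<longleftrightarrow> Y.asdim_le n" for n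
    using asdim_le_transfer assms d' by metis
  then show ?thesis unfolding group_asdim_def X.asdim_def Y.asdim_def by simp
qed

text \<open>The metric is the word metric for a proper integer weight on all group elements.\<close>

theorem ex_left_invariant_proper_metric:
  assumes "group G" "countable (carrier G)"
  shows "\<exists>d. left_invariant_proper_metric G d"
proof -
  interpret group G by fact
  let ?C = "carrier G"
  define e where "e = to_nat_on ?C"
  have e: "inj_on e ?C" unfolding e_def using assms(2) by (rule inj_on_to_nat_on)
  define w where "w g = Suc (e g + e (inv\<^bsub>G\<^esub> g))" for g
  define ev where "ev xs = foldr (\<otimes>\<^bsub>G\<^esub>) xs \<one>\<^bsub>G\<^esub>" for xs
  define wt where "wt xs = sum_list (map w xs)" for xs
  define L where "L g = (LEAST k. \<exists>xs. set xs \<subseteq> ?C \<and> ev xs = g \<and> wt xs = k)" for g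
  have canc: "x \<otimes>\<^bsub>G\<^esub> (inv\<^bsub>G\<^esub> x \<otimes>\<^bsub>G\<^esub> y) = y" "inv\<^bsub>G\<^esub> x \<otimes>\<^bsub>G\<^esub> (x \<otimes>\<^bsub>G\<^esub> y) = y"
    if "x \<in> ?C" "y \<in> ?C" for x y
    using that by (simp_all flip: m_assoc)
  have ev_closed: "ev xs \<in> ?C" if "set xs \<subseteq> ?C" for xs
    using that by (induction xs) (auto simp: ev_def)
  have ev_Cons: "ev (x # xs) = x \<otimes>\<^bsub>G\<^esub> ev xs" for x xs by (simp add: ev_def)
  have ev_append: "ev (xs @ ys) = ev xs \<otimes>\<^bsub>G\<^esub> ev ys" if "set xs \<subseteq> ?C" "set ys \<subseteq> ?C" for xs ys
    using that
  proof (induction xs)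
    case Nil then show ?case using ev_closed by (simp add: ev_def)
  next
    case (Cons x xs) then show ?case using ev_closed by (simp add: ev_Cons m_assoc)
  qed
  have ev_inv: "ev (rev (map (\<lambda>x. inv\<^bsub>G\<^esub> x) xs)) = inv\<^bsub>G\<^esub> (ev xs)" if "set xs \<subseteq> ?C" for xs
    using that
  proof (induction xs)
    case Nil then show ?case by (simp add: ev_def)
  next
    case (Cons x xs)
    have "ev (rev (map (\<lambda>x. inv\<^bsub>G\<^esub> x) (x # xs)))
        = ev (rev (map (\<lambda>x. inv\<^bsub>G\<^esub> x) xs)) \<otimes>\<^bsub>G\<^esub> ev [inv\<^bsub>G\<^esub> x]"
      unfolding list.map rev.simps using Cons.prems by (intro ev_append) auto
    also have "\<dots> = inv\<^bsub>G\<^esub> (ev xs) \<otimes>\<^bsub>G\<^esub> ev [inv\<^bsub>G\<^esub> x]"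
      using Cons by simp
    also have "ev [inv\<^bsub>G\<^esub> x] = inv\<^bsub>G\<^esub> x" using Cons.prems by (simp add: ev_def)
    also have "inv\<^bsub>G\<^esub> (ev xs) \<otimes>\<^bsub>G\<^esub> inv\<^bsub>G\<^esub> x = inv\<^bsub>G\<^esub> (ev (x # xs))"
      using Cons.prems ev_closed by (simp add: ev_Cons inv_mult_group)
    finally show ?case .
  qed
  have wt_inv: "wt (rev (map (\<lambda>x. inv\<^bsub>G\<^esub> x) xs)) = wt xs" if "set xs \<subseteq> ?C" for xs
    using that by (induction xs) (auto simp: wt_def w_def)
  have L_ex: "\<exists>xs. set xs \<subseteq> ?C \<and> ev xs = g \<and> wt xs = L g" if "g \<in> ?C" for g
    unfolding L_def by (rule LeastI[of _ "wt [g]"], rule exI[of _ "[g]"]) (simp add: that ev_def)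
  have L_le: "L (ev xs) \<le> wt xs" if "set xs \<subseteq> ?C" for xs
    unfolding L_def using that by (intro Least_le) auto
  have L_mult: "L (g \<otimes>\<^bsub>G\<^esub> h) \<le> L g + L h" if gh: "g \<in> ?C" "h \<in> ?C" for g h
  proof -
    obtain xs ys where xs: "set xs \<subseteq> ?C" "ev xs = g" "wt xs = L g"
      and ys: "set ys \<subseteq> ?C" "ev ys = h" "wt ys = L h"
      using L_ex gh by meson
    then show ?thesis using L_le[of "xs @ ys"] ev_append[of xs ys] by (simp add: wt_def)
  qed
  have L_inv_le: "L (inv\<^bsub>G\<^esub> g) \<le> L g" if g: "g \<in> ?C" for g
  proof -
    obtain xs where xs: "set xs \<subseteq> ?C" "ev xs = g" "wt xs = L g" using L_ex g by meson
    then have "set (rev (map (\<lambda>x. inv\<^bsub>G\<^esub> x) xs)) \<subseteq> ?C" by auto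
    from L_le[OF this] show ?thesis using xs ev_inv wt_inv by simp
  qed
  have L_inv: "L (inv\<^bsub>G\<^esub> g) = L g" if g: "g \<in> ?C" for g
    using L_inv_le[OF g] L_inv_le[of "inv\<^bsub>G\<^esub> g"] g by simp
  have L_one: "L \<one>\<^bsub>G\<^esub> = 0" using L_le[of "[]"] by (simp add: ev_def wt_def)
  have wt_len: "length xs \<le> wt xs" for xs
    by (induction xs) (auto simp: wt_def w_def)
  have L_zero: "g = \<one>\<^bsub>G\<^esub>" if g: "g \<in> ?C" "L g = 0" for g
  proof -
    obtain xs where "ev xs = g" "wt xs = L g" using L_ex g by meson
    then show ?thesis using wt_len[of xs] g by (simp add: ev_def)
  qed
  have fin: "finite {g \<in> ?C. L g \<le> n}" for n
  proof -
    let ?A = "{g \<in> ?C. w g \<le> n}"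
    have "finite (e -` {..n} \<inter> ?C)" by (rule finite_vimage_IntI[OF _ e]) simp
    then have "finite ?A" by (rule rev_finite_subset) (auto simp: w_def)
    then have "finite {xs. set xs \<subseteq> ?A \<and> length xs \<le> n}" by (rule finite_lists_length_le)
    moreover have "{g \<in> ?C. L g \<le> n} \<subseteq> ev ` {xs. set xs \<subseteq> ?A \<and> length xs \<le> n}"
    proof
      fix g assume g: "g \<in> {g \<in> ?C. L g \<le> n}"
      then obtain xs where xs: "set xs \<subseteq> ?C" "ev xs = g" "wt xs = L g" using L_ex by blast
      have "w x \<le> wt xs" if "x \<in> set xs" for x
        using that unfolding wt_def by (intro member_le_sum_list) auto
      then have "set xs \<subseteq> ?A" using xs g by force
      moreover have "length xs \<le> n" using xs g wt_len[of xs] by simp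
      ultimately show "g \<in> ev ` {xs. set xs \<subseteq> ?A \<and> length xs \<le> n}" using xs by blast
    qed
    ultimately show ?thesis by (meson finite_imageI finite_subset)
  qed
  define d where "d x y = (if x \<in> ?C \<and> y \<in> ?C then real (L (inv\<^bsub>G\<^esub> x \<otimes>\<^bsub>G\<^esub> y)) else 0)" for x y
  interpret Metric_space ?C d
  proof
    show "0 \<le> d x y" for x y by (simp add: d_def)
    show "d x y = d y x" for x y
    proof (cases "x \<in> ?C \<and> y \<in> ?C")
      case True
      then show ?thesis
        using L_inv[of "inv\<^bsub>G\<^esub> x \<otimes>\<^bsub>G\<^esub> y"] by (simp add: d_def inv_mult_group)
    qed (auto simp: d_def)
    show "d x y = 0 \<longleftrightarrow> x = y" if xy: "x \<in> ?C" "y \<in> ?C" for x y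
    proof
      assume "d x y = 0"
      then have "inv\<^bsub>G\<^esub> x \<otimes>\<^bsub>G\<^esub> y = \<one>\<^bsub>G\<^esub>"
        using xy by (intro L_zero) (simp_all add: d_def)
      then show "x = y" using canc(1)[OF xy] xy by simp
    qed (use xy L_one in \<open>simp add: d_def\<close>)
    show "d x z \<le> d x y + d y z" if xyz: "x \<in> ?C" "y \<in> ?C" "z \<in> ?C" for x y z
    proof -
      have "inv\<^bsub>G\<^esub> x \<otimes>\<^bsub>G\<^esub> z = (inv\<^bsub>G\<^esub> x \<otimes>\<^bsub>G\<^esub> y) \<otimes>\<^bsub>G\<^esub> (inv\<^bsub>G\<^esub> y \<otimes>\<^bsub>G\<^esub> z)"
        using xyz by (simp add: m_assoc canc)
      then have "L (inv\<^bsub>G\<^esub> x \<otimes>\<^bsub>G\<^esub> z) \<le> L (inv\<^bsub>G\<^esub> x \<otimes>\<^bsub>G\<^esub> y) + L (inv\<^bsub>G\<^esub> y \<otimes>\<^bsub>G\<^esub> z)"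
        using L_mult[of "inv\<^bsub>G\<^esub> x \<otimes>\<^bsub>G\<^esub> y" "inv\<^bsub>G\<^esub> y \<otimes>\<^bsub>G\<^esub> z"] xyz by simp
      then have "real (L (inv\<^bsub>G\<^esub> x \<otimes>\<^bsub>G\<^esub> z)) \<le> real (L (inv\<^bsub>G\<^esub> x \<otimes>\<^bsub>G\<^esub> y)) + real (L (inv\<^bsub>G\<^esub> y \<otimes>\<^bsub>G\<^esub> z))"
        by linarith
      then show ?thesis using xyz by (simp add: d_def)
    qed
  qed
  have mb: "mball x 1 = {x}" if "x \<in> ?C" for x
  proof -
    have "y = x" if "y \<in> ?C" "d x y < 1" for y
    proof -
      have "d x y = 0" using that \<open>x \<in> ?C\<close> by (simp add: d_def)
      then show ?thesis using that \<open>x \<in> ?C\<close> zero by blast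
    qed
    then show ?thesis using \<open>x \<in> ?C\<close> by (auto simp: mball_def)
  qed
  have "openin mtopology {x}" if "x \<in> ?C" for x
    using openin_mball[of x 1] mb[OF that] by simp
  then have top: "mtopology = discrete_topology ?C"
    using discrete_topology_unique[of ?C mtopology] by auto
  have "d (g \<otimes>\<^bsub>G\<^esub> x) (g \<otimes>\<^bsub>G\<^esub> y) = d x y" if gxy: "g \<in> ?C" "x \<in> ?C" "y \<in> ?C" for g x y
  proof -
    have "inv\<^bsub>G\<^esub> (g \<otimes>\<^bsub>G\<^esub> x) \<otimes>\<^bsub>G\<^esub> (g \<otimes>\<^bsub>G\<^esub> y) = inv\<^bsub>G\<^esub> x \<otimes>\<^bsub>G\<^esub> y"
      using gxy by (simp add: inv_mult_group m_assoc canc)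
    then show ?thesis using gxy by (simp add: d_def)
  qed
  moreover have "compactin mtopology (mcball x r)" if x: "x \<in> ?C" for x r
  proof -
    have "mcball x r \<subseteq> (\<lambda>g. x \<otimes>\<^bsub>G\<^esub> g) ` {g \<in> ?C. L g \<le> nat \<lfloor>r\<rfloor>}"
    proof
      fix y assume y: "y \<in> mcball x r"
      then have "y = x \<otimes>\<^bsub>G\<^esub> (inv\<^bsub>G\<^esub> x \<otimes>\<^bsub>G\<^esub> y)"
        using x by (simp add: canc)
      moreover have "real (L (inv\<^bsub>G\<^esub> x \<otimes>\<^bsub>G\<^esub> y)) \<le> r" using y x by (auto simp: d_def)
      then have "L (inv\<^bsub>G\<^esub> x \<otimes>\<^bsub>G\<^esub> y) \<le> nat \<lfloor>r\<rfloor>" by (simp add: le_nat_floor)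
      ultimately show "y \<in> (\<lambda>g. x \<otimes>\<^bsub>G\<^esub> g) ` {g \<in> ?C. L g \<le> nat \<lfloor>r\<rfloor>}"
        using x y by (intro image_eqI[of _ _ "inv\<^bsub>G\<^esub> x \<otimes>\<^bsub>G\<^esub> y"]) auto
    qed
    then have "finite (mcball x r)" using fin finite_subset by blast
    then show ?thesis unfolding top by (auto simp: compactin_discrete_topology)
  qed
  ultimately show ?thesis
    unfolding left_invariant_proper_metric_def using top Metric_space_axioms by blast
qed

end

theory Submission
  imports Defs
begin

text \<open>
  Write $K$ for the subset of $G$ in the statement. The inequality is a Hurewicz theorem for $f$:
  a map that sends nearby points to nearby points, and whose preimages of sets of bounded diameter
  have dimension at most $m$ in a uniform way, raises the dimension of its target by at most $m$.
  A quasimorphism satisfies both hypotheses. Nearby points of $G$ differ by one of finitely many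
  elements, so their images differ by one of finitely many elements
  (\<open>quasimorphism_bornologous\<close>). If $f(x) = f(y)$, comparing $f(x^{-1}y)$ with $f(x^{-1}x)$ shows
  $x^{-1}y \in K$ (\<open>quasimorphism_fibre\<close>), so a fibre lies in one left translate of $K$, and the
  preimage of a set of diameter at most $S$ lies in a union of $N(S)$ left translates of $K$
  (\<open>quasimorphism_preimage_bounded\<close>). Left translations are isometries, so all these unions have
  dimension at most $\operatorname{asdim} K$ with common bounds.

  The Hurewicz theorem (\<open>asdim_Hurewicz\<close>) rests on two devices.

  Kolmogorov's trick (\<open>colorable_Suc\<close>): a space of dimension at most $n$ has, for each $k > n$, not
  only a cover by $n + 1$ sets with uniformly bounded chain components but a family of $k$ such
  sets in which each point is missed by at most $n$ of them. With $k = n + m + 1$, take such a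
  family $V_c$ in the target (missed at most $n$ times) and such families $U_c$ over parts of the
  source (missed at most $m$ times). Some colour $c$ is then missed by neither, so the sets
  $U_c \cap f^{-1}(V_c)$ still cover.

  Growing scales (\<open>ex_layering\<close>): the families $U_c$ are chosen separately over the preimages of
  bounded pieces $Q$ of the target, and families over different pieces do not match. The pieces
  come in $n + 1$ types, and two pieces of one type are further apart than the diameter of the
  components of the $V_c$. A chain inside $U_c \cap f^{-1}(V_c)$ stays over one component of
  $V_c$, so it meets at most one piece of each type. If the scale for each type exceeds the bound
  obtained from the previous types, the union of one set per type has bounded components again
  (\<open>comp_bdd_Un\<close>).
\<close>

section \<open>Sets with bounded chain components\<close>

context Metric_space
begin

definition chain :: "real \<Rightarrow> 'a set \<Rightarrow> ('a \<times> 'a) set" where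
  "chain r A = {(x, y). x \<in> A \<and> y \<in> A \<and> d x y < r}\<^sup>*"

text \<open>
  The families of an asymptotic dimension cover are encoded by their unions: the \<open>r\<close>-disjoint
  bounded family is recovered as the set of \<open>r\<close>-chain components of \<open>A\<close>.
\<close>

definition comp_bdd :: "real \<Rightarrow> real \<Rightarrow> 'a set \<Rightarrow> bool" where
  "comp_bdd r D A \<longleftrightarrow> A \<subseteq> M \<and> (\<forall>x\<in>A. \<forall>y. (x, y) \<in> chain r A \<longrightarrow> d x y \<le> D)"

lemma chain_refl: "(x, x) \<in> chain r A"
  by (simp add: chain_def)

lemma chain_step: "(x, y) \<in> chain r A \<Longrightarrow> y \<in> A \<Longrightarrow> z \<in> A \<Longrightarrow> d y z < r \<Longrightarrow> (x, z) \<in> chain r A"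
  unfolding chain_def by (rule rtrancl_into_rtrancl) auto

lemma chain_trans: "(x, y) \<in> chain r A \<Longrightarrow> (y, z) \<in> chain r A \<Longrightarrow> (x, z) \<in> chain r A"
  by (simp add: chain_def)

lemma chain_sym: "(x, y) \<in> chain r A \<Longrightarrow> (y, x) \<in> chain r A"
proof -
  have "sym {(x, y). x \<in> A \<and> y \<in> A \<and> d x y < r}"
    by (auto simp: sym_def commute)
  then show "(x, y) \<in> chain r A \<Longrightarrow> (y, x) \<in> chain r A"
    unfolding chain_def by (meson sym_rtrancl symD)
qed

lemma chain_induct [consumes 2, case_names refl step]:
  assumes "(x, y) \<in> chain r A" "x \<in> A" "P x"
    and "\<And>y z. (x, y) \<in> chain r A \<Longrightarrow> y \<in> A \<Longrightarrow> z \<in> A \<Longrightarrow> d y z < r \<Longrightarrow> P y \<Longrightarrow> P z"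
  shows "P y"
  using assms(1) unfolding chain_def
proof (induction rule: rtrancl_induct)
  case base then show ?case by fact
next
  case (step y z)
  then show ?case using assms(4)[of y z] unfolding chain_def by blast
qed

lemma chain_in:
  assumes "(x, y) \<in> chain r A" "x \<in> A"
  shows "y \<in> A"
  using assms(1,2) assms(2) by (induction rule: chain_induct)

lemma comp_bdd_subset: "comp_bdd r D A \<Longrightarrow> A \<subseteq> M"
  by (simp add: comp_bdd_def)

lemma comp_bddD: "comp_bdd r D A \<Longrightarrow> x \<in> A \<Longrightarrow> (x, y) \<in> chain r A \<Longrightarrow> d x y \<le> D"
  by (simp add: comp_bdd_def)

lemma chain_mono: "A \<subseteq> B \<Longrightarrow> r \<le> s \<Longrightarrow> chain r A \<subseteq> chain s B"
  unfolding chain_def by (rule rtrancl_mono) auto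

lemma comp_bdd_mono:
  "comp_bdd s D B \<Longrightarrow> A \<subseteq> B \<Longrightarrow> r \<le> s \<Longrightarrow> D \<le> E \<Longrightarrow> comp_bdd r E A"
  unfolding comp_bdd_def using chain_mono[of A B r s] by (meson order_trans subsetD)

lemma comp_bdd_isometry:
  assumes A: "comp_bdd r D A"
    and \<phi>: "\<phi> ` M \<subseteq> M" "\<And>x y. x \<in> M \<Longrightarrow> y \<in> M \<Longrightarrow> d (\<phi> x) (\<phi> y) = d x y"
  shows "comp_bdd r D (\<phi> ` A)"
  unfolding comp_bdd_def
proof (intro conjI ballI allI impI)
  have AM: "A \<subseteq> M" using A by (rule comp_bdd_subset)
  then show "\<phi> ` A \<subseteq> M" using \<phi>(1) by blast
  fix x' y' assume x': "x' \<in> \<phi> ` A" and ch: "(x', y') \<in> chain r (\<phi> ` A)"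
  then obtain x where x: "x \<in> A" "x' = \<phi> x" by blast
  have "\<exists>y\<in>A. y' = \<phi> y \<and> (x, y) \<in> chain r A"
    using ch x'
  proof (induction rule: chain_induct)
    case refl then show ?case using x chain_refl by blast
  next
    case (step y' z')
    then obtain y z where "y \<in> A" "y' = \<phi> y" "(x, y) \<in> chain r A" "z \<in> A" "z' = \<phi> z" by blast
    then show ?case using step \<phi>(2) AM chain_step by (metis subsetD)
  qed
  then show "d x' y' \<le> D" using x \<phi>(2) AM comp_bddD[OF A] by (metis subsetD)
qed

text \<open>
  An \<open>r\<close>-chain in the union makes excursions into \<open>A\<close> between visits to \<open>B\<close>. An excursion stays
  in one component of \<open>A\<close>, so two consecutive visits are at distance less than
  \<open>D + 2 * r \<le> s\<close>, and the visits form an \<open>s\<close>-chain in \<open>B\<close>. Only the initial and the final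
  excursion add to \<open>E\<close>.
\<close>

lemma comp_bdd_Un:
  assumes A: "comp_bdd r D A" and B: "comp_bdd s E B"
    and "0 \<le> D" "0 \<le> E" "0 < r" and s: "D + 2 * r \<le> s"
  shows "comp_bdd r (2 * D + 2 * r + E) (A \<union> B)"
  unfolding comp_bdd_def
proof (intro conjI ballI allI impI)
  have AM: "A \<subseteq> M" and BM: "B \<subseteq> M" using A B by (auto dest: comp_bdd_subset)
  then show M: "A \<union> B \<subseteq> M" by simp
  fix x y assume x: "x \<in> A \<union> B" and ch: "(x, y) \<in> chain r (A \<union> B)"
  \<comment> \<open>\<open>near b y\<close>: the chain has reached \<open>y\<close> and \<open>b\<close> was its last visit to \<open>B\<close>.\<close>
  define near where "near b y \<longleftrightarrow> b = y \<or> (\<exists>a\<in>A. y \<in> A \<and> d b a < r \<and> (a, y) \<in> chain r A)" for b y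
  have near_le: "d b y \<le> D + r" if "near b y" "b \<in> B" "y \<in> A \<union> B" for b y
  proof (cases "b = y")
    case True then show ?thesis using that M \<open>0 \<le> D\<close> \<open>0 < r\<close> mdist_zero by auto
  next
    case False
    then obtain a where a: "a \<in> A" "d b a < r" "(a, y) \<in> chain r A" "y \<in> A"
      using \<open>near b y\<close> unfolding near_def by blast
    then show ?thesis
      using comp_bddD[OF A a(1,3)] triangle[of b a y] that AM BM by (smt (verit) subsetD)
  qed
  have "(x \<in> A \<and> y \<in> A \<and> (x, y) \<in> chain r A) \<or>
    (\<exists>b\<in>B. \<exists>b'\<in>B. d x b \<le> D + r \<and> (b, b') \<in> chain s B \<and> near b' y)"
    using ch x
  proof (induction rule: chain_induct)
    case refl
    show ?case
    proof (cases "x \<in> A")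
      case True then show ?thesis by (simp add: chain_refl)
    next
      case False
      then show ?thesis
        using x M \<open>0 \<le> D\<close> \<open>0 < r\<close> by (intro disjI2 bexI[of _ x]) (auto simp: near_def chain_refl)
    qed
  next
    case (step y z)
    from step(5) show ?case
    proof (elim disjE conjE bexE)
      assume y: "x \<in> A" "y \<in> A" "(x, y) \<in> chain r A"
      show ?thesis
      proof (cases "z \<in> A")
        case True then show ?thesis using y step chain_step by blast
      next
        case False
        then have "z \<in> B" using step by blast
        moreover have "d x z \<le> D + r"
          using comp_bddD[OF A y(1,3)] triangle[of x y z] step y(1) M by (smt (verit) subsetD UnCI)
        moreover have "near z z" by (simp add: near_def)
        ultimately show ?thesis using chain_refl by blast
      qed
    next
      fix b b' assume b: "b \<in> B" "b' \<in> B" "d x b \<le> D + r" "(b, b') \<in> chain s B" "near b' y"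
      show ?thesis
      proof (cases "z \<in> B")
        case True
        have "d b' z < s"
          using near_le[OF b(5,2)] triangle[of b' y z] step b(2) M s by (smt (verit) subsetD UnCI)
        then have "(b, z) \<in> chain s B" using b True chain_step by blast
        then show ?thesis using b True by (auto simp: near_def)
      next
        case False
        then have z: "z \<in> A" using step by blast
        have "near b' z"
        proof (cases "b' = y")
          case True then show ?thesis using z step chain_refl unfolding near_def by blast
        next
          case False
          then show ?thesis using b(5) z step chain_step unfolding near_def by blast
        qed
        then show ?thesis using b by blast
      qed
    qed
  qed
  then show "d x y \<le> 2 * D + 2 * r + E"
  proof (elim disjE conjE bexE)
    assume "x \<in> A" "(x, y) \<in> chain r A"
    then show ?thesis using comp_bddD[OF A] \<open>0 \<le> D\<close> \<open>0 \<le> E\<close> \<open>0 < r\<close> by fastforce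
  next
    fix b b' assume b: "b \<in> B" "b' \<in> B" "d x b \<le> D + r" "(b, b') \<in> chain s B" "near b' y"
    have y: "y \<in> A \<union> B" using chain_in[OF ch x] .
    have "d b' y \<le> D + r" using near_le b y by blast
    moreover have "d b b' \<le> E" using comp_bddD[OF B] b by blast
    moreover have "d x y \<le> d x b + (d b b' + d b' y)"
      using triangle[of x b y] triangle[of b b' y] x y b M by (smt (verit) subsetD UnCI)
    ultimately show ?thesis using b by linarith
  qed
qed


section \<open>Uniform multiple covers\<close>

text \<open>
  Each point of \<open>A\<close> is missed by at most \<open>m\<close> of the \<open>k\<close> sets; for \<open>k = Suc m\<close> this means that
  the sets cover \<open>A\<close>. The inequality is written without subtraction on the natural numbers.
\<close>

definition multicover ::
    "real \<Rightarrow> real \<Rightarrow> nat \<Rightarrow> nat \<Rightarrow> 'a set \<Rightarrow> (nat \<Rightarrow> 'a set) \<Rightarrow> bool" where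
  "multicover r D m k A W \<longleftrightarrow> (\<forall>i<k. W i \<subseteq> A \<and> comp_bdd r D (W i)) \<and>
     (\<forall>x\<in>A. k \<le> m + card {i. i < k \<and> x \<in> W i})"

text \<open>
  The bound \<open>D\<close> serves all members of \<open>\<A>\<close> at once. For \<open>k = Suc m\<close> this is the statement that
  the members of \<open>\<A>\<close> have asymptotic dimension at most \<open>m\<close> uniformly.
\<close>

definition colorable :: "'a set set \<Rightarrow> nat \<Rightarrow> nat \<Rightarrow> bool" where
  "colorable \<A> m k \<longleftrightarrow> (\<forall>r>0. \<exists>D\<ge>0. \<forall>A\<in>\<A>. \<exists>W. multicover r D m k A W)"

lemma multicoverI:
  assumes "\<And>i. i < k \<Longrightarrow> W i \<subseteq> A" "\<And>i. i < k \<Longrightarrow> comp_bdd r D (W i)"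
    and "\<And>x. x \<in> A \<Longrightarrow> k \<le> m + card {i. i < k \<and> x \<in> W i}"
  shows "multicover r D m k A W"
  using assms by (simp add: multicover_def)

lemma multicoverD:
  assumes "multicover r D m k A W"
  shows "i < k \<Longrightarrow> W i \<subseteq> A" "i < k \<Longrightarrow> comp_bdd r D (W i)"
    and "x \<in> A \<Longrightarrow> k \<le> m + card {i. i < k \<and> x \<in> W i}"
  using assms by (simp_all add: multicover_def)

lemma colorableI:
  assumes "\<And>r. r > 0 \<Longrightarrow> \<exists>D\<ge>0. \<forall>A\<in>\<A>. \<exists>W. multicover r D m k A W"
  shows "colorable \<A> m k"
  using assms by (simp add: colorable_def)

lemma colorableE:
  assumes "colorable \<A> m k" and "r > 0"
  obtains D W where "D \<ge> 0" "\<And>A. A \<in> \<A> \<Longrightarrow> multicover r D m k A (W A)"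
proof -
  obtain D where D: "D \<ge> 0" "\<forall>A\<in>\<A>. \<exists>W. multicover r D m k A W"
    using assms unfolding colorable_def by blast
  from bchoice[OF D(2)] obtain W where "\<forall>A\<in>\<A>. multicover r D m k A (W A)" ..
  then show thesis using that[OF D(1), of W] by simp
qed

lemma colorable_singletonE:
  assumes "colorable {A} m k" and "r > 0"
  obtains D W where "D \<ge> 0" "multicover r D m k A W"
  using assms unfolding colorable_def by auto

lemma colorable_subsets:
  assumes "colorable \<A> m k" and sub: "\<And>B. B \<in> \<B> \<Longrightarrow> \<exists>A\<in>\<A>. B \<subseteq> A"
  shows "colorable \<B> m k"
proof (rule colorableI)
  fix r :: real assume "r > 0"
  then obtain D W where D: "D \<ge> 0" and W: "\<And>A. A \<in> \<A> \<Longrightarrow> multicover r D m k A (W A)"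
    using colorableE[OF assms(1)] by metis
  have "\<exists>W. multicover r D m k B W" if B: "B \<in> \<B>" for B
  proof -
    obtain A where A: "A \<in> \<A>" "B \<subseteq> A" using sub[OF B] by blast
    have "multicover r D m k B (\<lambda>i. W A i \<inter> B)"
    proof (rule multicoverI)
      show "comp_bdd r D (W A i \<inter> B)" if "i < k" for i
        using comp_bdd_mono[OF multicoverD(2)[OF W[OF A(1)] that]] by simp
      show "k \<le> m + card {i. i < k \<and> x \<in> W A i \<inter> B}" if "x \<in> B" for x
        using multicoverD(3)[OF W[OF A(1)], of x] that A by auto
    qed simp
    then show ?thesis by blast
  qed
  then show "\<exists>D\<ge>0. \<forall>A\<in>\<B>. \<exists>W. multicover r D m k A W"
    using D by blast
qed

text \<open>
  Kolmogorov's trick. Replace the \<open>k\<close> sets, taken at scale \<open>3 * r\<close>, by their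
  \<open>r\<close>-neighbourhoods: \<open>r\<close>-chains there are shadowed by \<open>3 * r\<close>-chains in the original sets. A point
  that is now missed fewer than \<open>m\<close> times can be missed once more. The remaining
  points, missed exactly \<open>m\<close> times, form the new set: for them, lying in a set and lying in its
  neighbourhood are the same, so the collection of sets that contain the point is constant
  along \<open>r\<close>-chains, and since \<open>m < k\<close> a whole chain lies in one of the old sets.
\<close>

lemma colorable_Suc:
  assumes C: "colorable \<A> m k" and "m < k" and AM: "\<And>A. A \<in> \<A> \<Longrightarrow> A \<subseteq> M"
  shows "colorable \<A> m (Suc k)"
proof (rule colorableI)
  fix r :: real assume r: "r > 0"
  then have "3 * r > 0" by simp
  then obtain D \<W> where D: "D \<ge> 0" and \<W>: "\<And>A. A \<in> \<A> \<Longrightarrow> multicover (3 * r) D m k A (\<W> A)"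
    using colorableE[OF C] by metis
  have "\<exists>W. multicover r (D + 2 * r) m (Suc k) A W" if A: "A \<in> \<A>" for A
  proof -
    define W where "W = \<W> A"
    note W = multicoverD[OF \<W>[OF A], folded W_def]
    define N where "N i = {x \<in> A. \<exists>a\<in>W i. d x a < r}" for i
    define B where "B = {x \<in> A. m + card {i. i < k \<and> x \<in> N i} = k}"
    have WN: "W i \<subseteq> N i" if "i < k" for i
      using W(1)[OF that] AM[OF A] r mdist_zero unfolding N_def by (auto intro!: bexI)
    have N: "comp_bdd r (D + 2 * r) (N i)" if i: "i < k" for i
      unfolding comp_bdd_def
    proof (intro conjI ballI allI impI)
      show "N i \<subseteq> M" using AM[OF A] unfolding N_def by blast
      have WM: "W i \<subseteq> M" using W(1)[OF i] AM[OF A] by blast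
      fix x y assume x: "x \<in> N i" and ch: "(x, y) \<in> chain r (N i)"
      obtain a where a: "a \<in> W i" "d x a < r" using x unfolding N_def by blast
      have "\<exists>b\<in>W i. d y b < r \<and> (a, b) \<in> chain (3 * r) (W i)"
        using ch x
      proof (induction rule: chain_induct)
        case refl then show ?case using a chain_refl by blast
      next
        case (step y z)
        then obtain b where b: "b \<in> W i" "d y b < r" "(a, b) \<in> chain (3 * r) (W i)" by blast
        obtain c where c: "c \<in> W i" "d z c < r" using step unfolding N_def by blast
        have "y \<in> M" "z \<in> M" using step \<open>N i \<subseteq> M\<close> by auto
        then have "d b c < 3 * r"
          using triangle[of b y c] triangle[of y z c] commute[of b y] step b c WM
          by (smt (verit) subsetD)
        then show ?case using b c chain_step by blast
      qed
      then obtain b where b: "b \<in> W i" "d y b < r" "(a, b) \<in> chain (3 * r) (W i)" by blast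
      have "y \<in> M" "x \<in> M" using chain_in[OF ch x] x \<open>N i \<subseteq> M\<close> by auto
      then show "d x y \<le> D + 2 * r"
        using triangle[of x a y] triangle[of a b y] commute[of b y] a b WM
          comp_bddD[OF W(2)[OF i] a(1) b(3)]
        by (smt (verit) subsetD)
    qed
    define S where "S x = {i. i < k \<and> x \<in> W i}" for x
    have fin: "finite {i. i < k \<and> P i}" for P by (rule finite_subset[of _ "{..<k}"]) auto
    have SN: "S x = {i. i < k \<and> x \<in> N i}" if "x \<in> B" for x
      unfolding S_def
    proof (rule card_seteq)
      show "{i. i < k \<and> x \<in> W i} \<subseteq> {i. i < k \<and> x \<in> N i}" using WN by blast
      show "card {i. i < k \<and> x \<in> N i} \<le> card {i. i < k \<and> x \<in> W i}"
        using that W(3)[of x] unfolding B_def by auto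
    qed (rule fin)
    have BM: "B \<subseteq> M" using AM[OF A] unfolding B_def by blast
    have sub: "S x \<subseteq> S y" if "x \<in> B" "y \<in> B" "d x y < r" for x y
    proof -
      have "S x \<subseteq> {i. i < k \<and> y \<in> N i}"
        unfolding S_def N_def using that commute[of x y] by (auto simp: B_def)
      then show ?thesis using SN that by blast
    qed
    have B: "comp_bdd r (D + 2 * r) B"
      unfolding comp_bdd_def
    proof (intro conjI ballI allI impI BM)
      fix x y assume x: "x \<in> B" and ch: "(x, y) \<in> chain r B"
      have "k \<le> m + card (S x)" using W(3)[of x] x unfolding S_def B_def by auto
      then have "S x \<noteq> {}" using \<open>m < k\<close> by auto
      then obtain i where i: "i < k" "x \<in> W i" unfolding S_def by blast
      have "i \<in> S y \<and> (x, y) \<in> chain (3 * r) (W i)"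
        using ch x
      proof (induction rule: chain_induct)
        case refl then show ?case using i chain_refl by (simp add: S_def)
      next
        case (step y z)
        then have "i \<in> S z" using sub by blast
        moreover have "d y z < 3 * r" using step r by simp
        ultimately show ?case using step chain_step unfolding S_def by blast
      qed
      then show "d x y \<le> D + 2 * r" using comp_bddD[OF W(2)[OF i(1)] i(2)] r by fastforce
    qed
    define W' where "W' i = (if i = k then B else N i)" for i
    have "multicover r (D + 2 * r) m (Suc k) A W'"
    proof (rule multicoverI)
      show "W' i \<subseteq> A" for i by (auto simp: W'_def B_def N_def)
      show "comp_bdd r (D + 2 * r) (W' i)" if "i < Suc k" for i
        using that N B by (auto simp: W'_def)
      fix x assume x: "x \<in> A"
      have "card {i. i < k \<and> x \<in> W i} \<le> card {i. i < k \<and> x \<in> N i}"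
        by (rule card_mono[OF fin]) (use WN in blast)
      then have le: "k \<le> m + card {i. i < k \<and> x \<in> N i}"
        using W(3)[OF x] by linarith
      show "Suc k \<le> m + card {i. i < Suc k \<and> x \<in> W' i}"
      proof (cases "x \<in> B")
        case True
        then have "{i. i < Suc k \<and> x \<in> W' i} = insert k {i. i < k \<and> x \<in> N i}"
          by (auto simp: W'_def)
        then show ?thesis using le fin by simp
      next
        case False
        then have "{i. i < Suc k \<and> x \<in> W' i} = {i. i < k \<and> x \<in> N i}"
          by (auto simp: W'_def less_Suc_eq)
        then show ?thesis using le False x unfolding B_def by auto
      qed
    qed
    then show ?thesis by blast
  qed
  then show "\<exists>D\<ge>0. \<forall>A\<in>\<A>. \<exists>W. multicover r D m (Suc k) A W"
    using D r by (intro exI[of _ "D + 2 * r"]) simp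
qed

lemma colorable_ge:
  assumes "colorable \<A> m (Suc m)" and "\<And>A. A \<in> \<A> \<Longrightarrow> A \<subseteq> M" and "m < k"
  shows "colorable \<A> m k"
proof -
  from \<open>m < k\<close> have "Suc m \<le> k" by simp
  then show ?thesis
  proof (induction k rule: dec_induct)
    case base then show ?case using assms(1) .
  next
    case (step k) then show ?case using colorable_Suc assms(2) by simp
  qed
qed

text \<open>
  Families of multiple covers of the members of \<open>\<B>\<close>, one family for each layer \<open>i < N\<close>, such that
  any choice of one member \<open>B i\<close> per layer, the same member being allowed in several layers, leads
  to a union with bounded components in each colour \<open>c\<close>. The bound \<open>E\<close> does not depend on the
  choice, and that is what makes the order of quantifiers work: \<open>U\<close> is fixed before \<open>B\<close>.
\<close>

definition layering ::
    "real \<Rightarrow> real \<Rightarrow> nat \<Rightarrow> nat \<Rightarrow> 'a set set \<Rightarrow> nat \<Rightarrow> (nat \<Rightarrow> 'a set \<Rightarrow> nat \<Rightarrow> 'a set) \<Rightarrow> bool" where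
  "layering r E m k \<B> N U \<longleftrightarrow>
     (\<forall>i<N. \<forall>B\<in>\<B>. (\<forall>c<k. U i B c \<subseteq> B) \<and> (\<forall>x\<in>B. k \<le> m + card {c. c < k \<and> x \<in> U i B c})) \<and>
     (\<forall>c<k. \<forall>B. (\<forall>i<N. B i \<in> \<B>) \<longrightarrow> comp_bdd r E (\<Union>i<N. U i (B i) c))"

lemma layeringD:
  assumes "layering r E m k \<B> N U"
  shows "i < N \<Longrightarrow> B \<in> \<B> \<Longrightarrow> c < k \<Longrightarrow> U i B c \<subseteq> B"
    and "i < N \<Longrightarrow> B \<in> \<B> \<Longrightarrow> x \<in> B \<Longrightarrow> k \<le> m + card {c. c < k \<and> x \<in> U i B c}"
    and "c < k \<Longrightarrow> (\<And>i. i < N \<Longrightarrow> B' i \<in> \<B>) \<Longrightarrow> comp_bdd r E (\<Union>i<N. U i (B' i) c)"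
  using assms by (simp_all add: layering_def)

text \<open>
  The layer \<open>N\<close> is covered at a scale larger than the bound of the union of the layers below it,
  so \<open>comp_bdd_Un\<close> applies.
\<close>

lemma ex_layering:
  assumes C: "colorable \<B> m k" and r: "r > 0"
  shows "\<exists>E\<ge>0. \<exists>U. layering r E m k \<B> N U"
proof (induction N)
  case 0
  then show ?case by (intro exI[of _ 0]) (simp add: layering_def comp_bdd_def)
next
  case (Suc N)
  then obtain E U where E: "E \<ge> 0" and "layering r E m k \<B> N U"
    by blast
  note U = layeringD[OF this(2)]
  have "E + 2 * r > 0" using E r by simp
  then obtain D W where D: "D \<ge> 0" and "\<And>A. A \<in> \<B> \<Longrightarrow> multicover (E + 2 * r) D m k A (W A)"
    using colorableE[OF C] by metis
  note W = multicoverD[OF this(2)]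
  let ?U = "U(N := W)"
  have "comp_bdd r (2 * E + 2 * r + D) (\<Union>i<Suc N. ?U i (B i) c)" if "c < k" "\<forall>i<Suc N. B i \<in> \<B>" for c B
  proof -
    have "(\<Union>i<Suc N. ?U i (B i) c) = (\<Union>i<N. U i (B i) c) \<union> W (B N) c"
      by (auto simp: lessThan_Suc)
    moreover have "comp_bdd r E (\<Union>i<N. U i (B i) c)" using U(3) that by simp
    moreover have "comp_bdd (E + 2 * r) D (W (B N) c)" using W(2) that by simp
    ultimately show ?thesis using comp_bdd_Un[of r E _ "E + 2 * r" D] E D r by simp
  qed
  moreover have "\<forall>i<Suc N. \<forall>B\<in>\<B>. (\<forall>c<k. ?U i B c \<subseteq> B) \<and> (\<forall>x\<in>B. k \<le> m + card {c. c < k \<and> x \<in> ?U i B c})"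
    using U(1,2) W(1,3) by (simp add: less_Suc_eq)
  moreover have "2 * E + 2 * r + D \<ge> 0" using E D r by simp
  ultimately show ?case
    by (intro exI[of _ "2 * E + 2 * r + D"] conjI exI[of _ ?U]) (simp_all add: layering_def)
qed

lemma colorable_unions:
  assumes C: "colorable \<B> m k"
  shows "colorable {\<Union>i<N::nat. B i |B. \<forall>i<N. B i \<in> \<B>} m k"
proof (rule colorableI)
  fix r :: real assume "r > 0"
  from ex_layering[OF C this, of N] obtain E U where E: "E \<ge> 0" and "layering r E m k \<B> N U"
    by blast
  note U = layeringD[OF this(2)]
  have "multicover r E m k (\<Union>i<N. B i) (\<lambda>c. \<Union>i<N. U i (B i) c)" if B: "\<forall>i<N. B i \<in> \<B>" for B
  proof (rule multicoverI)
    fix c assume "c < k"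
    show "(\<Union>i<N. U i (B i) c) \<subseteq> (\<Union>i<N. B i)"
      using U(1) B \<open>c < k\<close> by (intro UN_mono) auto
    show "comp_bdd r E (\<Union>i<N. U i (B i) c)"
      using U(3)[OF \<open>c < k\<close>] B by simp
  next
    fix x assume "x \<in> (\<Union>i<N. B i)"
    then obtain i where i: "i < N" "x \<in> B i" by blast
    have "card {c. c < k \<and> x \<in> U i (B i) c} \<le> card {c. c < k \<and> x \<in> (\<Union>i<N. U i (B i) c)}"
      by (rule card_mono) (use i in auto)
    then show "k \<le> m + card {c. c < k \<and> x \<in> (\<Union>i<N. U i (B i) c)}"
      using U(2)[of i "B i" x] i B by simp
  qed
  then show "\<exists>D\<ge>0. \<forall>A\<in>{\<Union>i<N. B i |B. \<forall>i<N. B i \<in> \<B>}. \<exists>W. multicover r D m k A W"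
    using E by blast
qed

lemma colorable_isometric_images:
  assumes C: "colorable \<A> m k"
    and \<Phi>: "\<And>\<phi>. \<phi> \<in> \<Phi> \<Longrightarrow> \<phi> ` M \<subseteq> M"
      "\<And>\<phi> x y. \<phi> \<in> \<Phi> \<Longrightarrow> x \<in> M \<Longrightarrow> y \<in> M \<Longrightarrow> d (\<phi> x) (\<phi> y) = d x y"
  shows "colorable {\<phi> ` A |\<phi> A. \<phi> \<in> \<Phi> \<and> A \<in> \<A>} m k"
proof (rule colorableI)
  fix r :: real assume "r > 0"
  then obtain D \<W> where D: "D \<ge> 0" and \<W>: "\<And>A. A \<in> \<A> \<Longrightarrow> multicover r D m k A (\<W> A)"
    using colorableE[OF C] by metis
  have "\<exists>W. multicover r D m k (\<phi> ` A) W" if A: "A \<in> \<A>" and \<phi>: "\<phi> \<in> \<Phi>" for A \<phi>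
  proof -
    define W where "W = \<W> A"
    note W = multicoverD[OF \<W>[OF A], folded W_def]
    have "multicover r D m k (\<phi> ` A) (\<lambda>i. \<phi> ` W i)"
    proof (rule multicoverI)
      show "\<phi> ` W i \<subseteq> \<phi> ` A" if "i < k" for i using W(1)[OF that] by blast
      show "comp_bdd r D (\<phi> ` W i)" if "i < k" for i
        using comp_bdd_isometry[OF W(2)[OF that] \<Phi>(1)[OF \<phi>] \<Phi>(2)[OF \<phi>]] by simp
      fix x' assume "x' \<in> \<phi> ` A"
      then obtain x where x: "x \<in> A" "x' = \<phi> x" by blast
      have "card {i. i < k \<and> x \<in> W i} \<le> card {i. i < k \<and> x' \<in> \<phi> ` W i}"
        by (rule card_mono) (use x in auto)
      then show "k \<le> m + card {i. i < k \<and> x' \<in> \<phi> ` W i}" using W(3)[OF x(1)] by simp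
    qed
    then show ?thesis by blast
  qed
  then show "\<exists>D\<ge>0. \<forall>A\<in>{\<phi> ` A |\<phi> A. \<phi> \<in> \<Phi> \<and> A \<in> \<A>}. \<exists>W. multicover r D m k A W"
    using D by blast
qed

text \<open>
  A chain with steps shorter than \<open>r\<close> cannot leave a member of an \<open>r\<close>-disjoint family within the
  union of the family; conversely, distinct chain components are at distance at least \<open>r\<close>.
\<close>

lemma asdim_le_iff_colorable: "asdim_le n \<longleftrightarrow> colorable {M} n (Suc n)"
proof
  assume L: "asdim_le n"
  show "colorable {M} n (Suc n)"
  proof (rule colorableI)
    fix r :: real assume "r > 0"
    then obtain \<U> D where U: "(\<Union>i\<le>n. \<Union>(\<U> i)) = M" "D > 0"
        "\<And>i U V. i \<le> n \<Longrightarrow> U \<in> \<U> i \<Longrightarrow> V \<in> \<U> i \<Longrightarrow> U \<noteq> V \<Longrightarrow> set_gap U V \<ge> ereal r"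
        "\<And>i U. i \<le> n \<Longrightarrow> U \<in> \<U> i \<Longrightarrow> set_diam U \<le> ereal D"
      using L unfolding asdim_le_def by metis
    have "comp_bdd r D (\<Union>(\<U> i))" if i: "i \<le> n" for i
      unfolding comp_bdd_def
    proof (intro conjI ballI allI impI)
      show "\<Union>(\<U> i) \<subseteq> M" using U(1) i by blast
      fix x y assume x: "x \<in> \<Union>(\<U> i)" and ch: "(x, y) \<in> chain r (\<Union>(\<U> i))"
      then obtain U where xU: "x \<in> U" "U \<in> \<U> i" by blast
      from ch x have "y \<in> U"
      proof (induction rule: chain_induct)
        case refl then show ?case using xU by simp
      next
        case (step y z)
        then obtain V where V: "z \<in> V" "V \<in> \<U> i" by blast
        have "U = V"
        proof (rule ccontr)
          assume "U \<noteq> V"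
          then have "d y z \<ge> r"
            using U(3)[OF i xU(2) V(2)] step(5) V(1) unfolding set_gap_ge_iff by blast
          then show False using step(4) by simp
        qed
        then show ?case using V(1) by simp
      qed
      then show "d x y \<le> D" using U(4)[OF i xU(2)] xU set_diam_le_iff by blast
    qed
    moreover have "Suc n \<le> n + card {i. i < Suc n \<and> x \<in> \<Union>(\<U> i)}" if x: "x \<in> M" for x
    proof -
      obtain i where "i \<le> n" "x \<in> \<Union>(\<U> i)" using x unfolding U(1)[symmetric] by blast
      then have "{i. i < Suc n \<and> x \<in> \<Union>(\<U> i)} \<noteq> {}" unfolding less_Suc_eq_le by blast
      then have "card {i. i < Suc n \<and> x \<in> \<Union>(\<U> i)} > 0" by (simp add: card_gt_0_iff)
      then show ?thesis by simp
    qed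
    ultimately have "multicover r D n (Suc n) M (\<lambda>i. \<Union>(\<U> i))"
      unfolding multicover_def less_Suc_eq_le by (meson comp_bdd_subset)
    moreover have "D \<ge> 0" using U(2) by simp
    ultimately show "\<exists>D\<ge>0. \<forall>A\<in>{M}. \<exists>W. multicover r D n (Suc n) A W"
      by blast
  qed
next
  assume C: "colorable {M} n (Suc n)"
  show "asdim_le n"
    unfolding asdim_le_def
  proof (intro allI impI)
    fix r :: real assume r: "r > 0"
    obtain D W where D: "D \<ge> 0" and "multicover r D n (Suc n) M W"
      by (rule colorable_singletonE[OF C r])
    note W = multicoverD(2,3)[OF this(2), unfolded less_Suc_eq_le]
    define \<U> where "\<U> i = {{y. (x, y) \<in> chain r (W i)} |x. x \<in> W i}" for i
    have cover: "\<Union>(\<U> i) = W i" for i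
    proof
      show "\<Union>(\<U> i) \<subseteq> W i" unfolding \<U>_def by (auto dest: chain_in)
      show "W i \<subseteq> \<Union>(\<U> i)"
      proof
        fix x assume x: "x \<in> W i"
        then have "{y. (x, y) \<in> chain r (W i)} \<in> \<U> i" unfolding \<U>_def by blast
        then show "x \<in> \<Union>(\<U> i)" using chain_refl by (intro UnionI) auto
      qed
    qed
    have "(\<Union>i\<le>n. W i) = M"
    proof
      show "(\<Union>i\<le>n. W i) \<subseteq> M" using W(1) comp_bdd_subset by blast
      show "M \<subseteq> (\<Union>i\<le>n. W i)"
      proof
        fix x assume "x \<in> M"
        then have "card {i. i \<le> n \<and> x \<in> W i} > 0" using W(2)[of x] by linarith
        then have "{i. i \<le> n \<and> x \<in> W i} \<noteq> {}" using card_gt_0_iff by blast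
        then show "x \<in> (\<Union>i\<le>n. W i)" by (auto simp: less_Suc_eq_le)
      qed
    qed
    moreover have "set_gap U V \<ge> ereal r" if UV: "U \<in> \<U> i" "V \<in> \<U> i" "U \<noteq> V" for i U V
      unfolding set_gap_ge_iff
    proof (intro ballI)
      fix u v assume u: "u \<in> U" and v: "v \<in> V"
      obtain x y where x: "x \<in> W i" "U = {z. (x, z) \<in> chain r (W i)}"
        and y: "y \<in> W i" "V = {z. (y, z) \<in> chain r (W i)}" using UV unfolding \<U>_def by blast
      show "d u v \<ge> r"
      proof (rule ccontr)
        assume "\<not> d u v \<ge> r"
        moreover have xu: "(x, u) \<in> chain r (W i)" and yv: "(y, v) \<in> chain r (W i)"
          using u v x(2) y(2) by simp_all
        moreover have "u \<in> W i" "v \<in> W i"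
          using chain_in[OF xu x(1)] chain_in[OF yv y(1)] .
        ultimately have "(u, v) \<in> chain r (W i)" using chain_step[OF chain_refl] by simp
        then have xy: "(x, y) \<in> chain r (W i)"
          using chain_trans[OF chain_trans[OF xu] chain_sym[OF yv]] by simp
        have "U = V" unfolding x(2) y(2)
          using chain_trans[OF xy] chain_trans[OF chain_sym[OF xy]] by blast
        then show False using UV by blast
      qed
    qed
    moreover have "set_diam U \<le> ereal (D + 1)" if "i \<le> n" "U \<in> \<U> i" for i U
      unfolding set_diam_le_iff
    proof (intro ballI)
      fix u v assume uv: "u \<in> U" "v \<in> U"
      obtain x where x: "x \<in> W i" "U = {z. (x, z) \<in> chain r (W i)}"
        using \<open>U \<in> \<U> i\<close> unfolding \<U>_def by blast
      then have xu: "(x, u) \<in> chain r (W i)" and xv: "(x, v) \<in> chain r (W i)" using uv by simp_all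
      have "d u v \<le> D"
        using comp_bddD[OF W(1)[OF that(1)] chain_in[OF xu x(1)] chain_trans[OF chain_sym[OF xu] xv]] .
      then show "d u v \<le> D + 1" by simp
    qed
    ultimately show "\<exists>\<U>. (\<Union>i\<le>n. \<Union>(\<U> i)) = M \<and>
          (\<forall>i\<le>n. \<forall>U\<in>\<U> i. \<forall>V\<in>\<U> i. U \<noteq> V \<longrightarrow> set_gap U V \<ge> ereal r) \<and>
          (\<exists>D::real. D > 0 \<and> (\<forall>i\<le>n. \<forall>U\<in>\<U> i. set_diam U \<le> ereal D))"
      using D by (intro exI[of _ \<U>] conjI exI[of _ "D + 1"]) (simp_all add: cover)
  qed
qed

lemma asdim_finite_imp_asdim_le:
  assumes "asdim = enat n"
  shows "asdim_le n"
proof -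
  have "{enat n |n. asdim_le n} \<noteq> {}"
    using assms unfolding asdim_def by (metis Inf_enat_def enat.distinct(1) infinity_enat_def)
  then have "Inf {enat n |n. asdim_le n} \<in> {enat n |n. asdim_le n}"
    unfolding Inf_enat_def by (metis (mono_tags, lifting) LeastI equals0I)
  then show ?thesis using assms unfolding asdim_def by auto
qed

end

lemma (in Metric_space) colorable_subspace:
  assumes "A \<subseteq> M" and "Metric_space.colorable A d {A} m k"
  shows "colorable {A} m k"
proof -
  interpret S: Metric_space A d using assms(1) by (rule subspace)
  have "comp_bdd r D W" if "S.comp_bdd r D W" for r D W
    using that assms(1) unfolding comp_bdd_def S.comp_bdd_def chain_def S.chain_def by blast
  then show ?thesis using assms(2) unfolding colorable_def S.colorable_def multicover_def S.multicover_def
    by simp meson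
qed


section \<open>The Hurewicz theorem for asymptotic dimension\<close>

text \<open>
  The order of the choices matters: the components of the sets \<open>V c\<close> have diameter at most \<open>S\<close>;
  then the target is cut into bounded pieces, in \<open>n + 1\<close> families \<open>\<P> i\<close> with gaps larger than
  \<open>2 * S\<close>; the last choice is that of the layers over the preimages of these pieces.
\<close>

theorem asdim_Hurewicz:
  assumes "Metric_space M1 d1" and "Metric_space M2 d2"
    and f: "f ` M1 \<subseteq> M2"
    and bornologous: "\<And>r. \<exists>R>0. \<forall>x\<in>M1. \<forall>y\<in>M1. d1 x y < r \<longrightarrow> d2 (f x) (f y) < R"
    and n: "Metric_space.asdim_le M2 d2 n"
    and m: "\<And>S. Metric_space.colorable M1 d1
              {f -` B \<inter> M1 |B. \<forall>u\<in>B. \<forall>v\<in>B. d2 u v \<le> S} m (Suc m)"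
  shows "Metric_space.asdim_le M1 d1 (n + m)"
proof -
  interpret X: Metric_space M1 d1 by fact
  interpret Y: Metric_space M2 d2 by fact
  let ?k = "Suc (n + m)"
  show ?thesis unfolding X.asdim_le_iff_colorable
  proof (rule X.colorableI)
    fix r :: real assume r: "r > 0"
    obtain R where R: "R > 0" "\<And>x y. x \<in> M1 \<Longrightarrow> y \<in> M1 \<Longrightarrow> d1 x y < r \<Longrightarrow> d2 (f x) (f y) < R"
      using bornologous by blast
    have CY: "Y.colorable {M2} n ?k"
      using n Y.colorable_ge[of "{M2}" n ?k] by (simp add: Y.asdim_le_iff_colorable)
    obtain S V where S: "S \<ge> 0" and "Y.multicover R S n ?k M2 V"
      by (rule Y.colorable_singletonE[OF CY \<open>R > 0\<close>])
    note V = Y.multicoverD(2,3)[OF this(2)]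
    \<comment> \<open>Points of one chain component of \<open>V c\<close> are compared through a base point at distance at most
      \<open>S\<close> from each, so with this gap the component meets at most one piece from each \<open>\<P> i\<close>.\<close>
    have "2 * S + 1 > 0" using S by simp
    then obtain \<P> S' where P: "(\<Union>i\<le>n. \<Union>(\<P> i)) = M2"
        "\<And>i U V. i \<le> n \<Longrightarrow> U \<in> \<P> i \<Longrightarrow> V \<in> \<P> i \<Longrightarrow> U \<noteq> V \<Longrightarrow> Y.set_gap U V \<ge> ereal (2 * S + 1)"
        "\<And>i U. i \<le> n \<Longrightarrow> U \<in> \<P> i \<Longrightarrow> Y.set_diam U \<le> ereal S'"
      using n unfolding Y.asdim_le_def by metis
    define \<B> where "\<B> = {f -` B \<inter> M1 |B. \<forall>u\<in>B. \<forall>v\<in>B. d2 u v \<le> S'}"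
    have PB: "f -` U \<inter> M1 \<in> \<B>" if "i \<le> n" "U \<in> \<P> i" for i U
      using P(3)[OF that] unfolding \<B>_def Y.set_diam_le_iff by blast
    have emB: "f -` {} \<inter> M1 \<in> \<B>" unfolding \<B>_def by blast
    have "X.colorable \<B> m ?k"
      by (rule X.colorable_ge[OF m[of S', folded \<B>_def]]) (auto simp: \<B>_def)
    from X.ex_layering[OF this r, of "Suc n"] obtain E U where E: "E \<ge> 0"
      and "X.layering r E m ?k \<B> (Suc n) U"
      by blast
    note L = X.layeringD[OF this(2)]
    have U: "i \<le> n \<Longrightarrow> B \<in> \<B> \<Longrightarrow> c < ?k \<Longrightarrow> U i B c \<subseteq> B"
        "i \<le> n \<Longrightarrow> B \<in> \<B> \<Longrightarrow> x \<in> B \<Longrightarrow> ?k \<le> m + card {c. c < ?k \<and> x \<in> U i B c}"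
        "c < ?k \<Longrightarrow> (\<And>i. i \<le> n \<Longrightarrow> B' i \<in> \<B>) \<Longrightarrow> X.comp_bdd r E (\<Union>i\<le>n. U i (B' i) c)"
      for i B B' c x
      using L(1)[of i B c] L(2)[of i B x] L(3)[of c B'] by (simp_all only: less_Suc_eq_le lessThan_Suc_atMost)
    define W where "W c = {x \<in> M1. f x \<in> V c \<and> (\<exists>i\<le>n. \<exists>Q\<in>\<P> i. x \<in> U i (f -` Q \<inter> M1) c)}" for c
    have bdd: "X.comp_bdd r E (W c)" if c: "c < ?k" for c
      unfolding X.comp_bdd_def
    proof (intro conjI ballI allI impI)
      show "W c \<subseteq> M1" unfolding W_def by blast
      fix x y assume x: "x \<in> W c" and ch: "(x, y) \<in> X.chain r (W c)"
      define C where "C = {z. (x, z) \<in> X.chain r (W c)}"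
      have CW: "C \<subseteq> W c" unfolding C_def using X.chain_in x by blast
      have fM: "f z \<in> M2" if "z \<in> W c" for z using that f unfolding W_def by blast
      have CS: "d2 (f x) (f z) \<le> S" if "z \<in> C" for z
      proof -
        have "(x, z) \<in> X.chain r (W c)" using that unfolding C_def by simp
        then have "(f x, f z) \<in> Y.chain R (V c)" using x
        proof (induction rule: X.chain_induct)
          case refl then show ?case by (rule Y.chain_refl)
        next
          case (step y z)
          then show ?case using R(2)[of y z] Y.chain_step unfolding W_def by blast
        qed
        then show ?thesis using Y.comp_bddD[OF V(1)[OF c]] x unfolding W_def by blast
      qed
      \<comment> \<open>The piece of type \<open>i\<close> that the chain component of \<open>x\<close> lies over. If there is none, the empty
        set is used: its preimage is also a member of \<open>\<B>\<close>.\<close>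
      define Q where "Q i = (if \<exists>Q\<in>\<P> i. Q \<inter> f ` C \<noteq> {} then SOME Q. Q \<in> \<P> i \<and> Q \<inter> f ` C \<noteq> {} else {})" for i
      have Q: "Q i \<in> \<P> i \<and> Q i \<inter> f ` C \<noteq> {}" if "T \<in> \<P> i" "T \<inter> f ` C \<noteq> {}" for i T
        unfolding Q_def using that someI[of "\<lambda>Q. Q \<in> \<P> i \<and> Q \<inter> f ` C \<noteq> {}"]
        by (smt (verit) someI_ex)
      have Q_unique: "T = Q i" if i: "i \<le> n" and T: "T \<in> \<P> i" "T \<inter> f ` C \<noteq> {}" for i T
      proof (rule ccontr)
        assume ne: "T \<noteq> Q i"
        obtain u v where u: "u \<in> C" "f u \<in> T" and v: "v \<in> C" "f v \<in> Q i" using Q[OF T] T by blast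
        have "d2 (f u) (f v) \<ge> 2 * S + 1"
          using P(2)[OF i T(1) _ ne] Q[OF T] u v unfolding Y.set_gap_ge_iff by blast
        moreover have "d2 (f u) (f v) \<le> d2 (f x) (f u) + d2 (f x) (f v)"
          using Y.triangle[of "f u" "f x" "f v"] Y.commute[of "f x" "f u"] fM CW u v x by auto
        ultimately show False using CS[of u] CS[of v] u v by simp
      qed
      have QB: "f -` Q i \<inter> M1 \<in> \<B>" if "i \<le> n" for i
      proof (cases "\<exists>T\<in>\<P> i. T \<inter> f ` C \<noteq> {}")
        case True then show ?thesis using Q PB that by blast
      next
        case False then have "Q i = {}" unfolding Q_def by simp
        then show ?thesis using emB by simp
      qed
      let ?Z = "\<Union>i\<le>n. U i (f -` Q i \<inter> M1) c"
      have CZ: "C \<subseteq> ?Z"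
      proof
        fix z assume z: "z \<in> C"
        then obtain i T where T: "i \<le> n" "T \<in> \<P> i" "z \<in> U i (f -` T \<inter> M1) c"
          using CW unfolding W_def by blast
        have "f z \<in> T" using U(1)[OF T(1) PB[OF T(1,2)] c] T(3) by blast
        then have "T = Q i" using Q_unique[OF T(1,2)] z by blast
        then show "z \<in> ?Z" using T by blast
      qed
      have "(x, y) \<in> X.chain r ?Z"
        using ch x
      proof (induction rule: X.chain_induct)
        case refl then show ?case by (rule X.chain_refl)
      next
        case (step y z)
        have "y \<in> C" using step unfolding C_def by simp
        moreover have "z \<in> C" using X.chain_step[OF step(1-4)] unfolding C_def by simp
        ultimately have "y \<in> ?Z" "z \<in> ?Z" using CZ by auto
        then show ?case using step(4) by (rule X.chain_step[OF step(5)])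
      qed
      moreover have "x \<in> ?Z" by (rule subsetD[OF CZ]) (simp add: C_def X.chain_refl)
      moreover have "X.comp_bdd r E ?Z" using QB by (rule U(3)[OF c])
      ultimately show "d1 x y \<le> E" by (intro X.comp_bddD)
    qed
    have covers: "?k \<le> n + m + card {c. c < ?k \<and> x \<in> W c}" if x: "x \<in> M1" for x
    proof -
      have "f x \<in> M2" using x f by blast
      then obtain i T where T: "i \<le> n" "T \<in> \<P> i" "f x \<in> T" using P(1) by blast
      let ?A = "{c. c < ?k \<and> f x \<in> V c}" and ?B = "{c. c < ?k \<and> x \<in> U i (f -` T \<inter> M1) c}"
      have "?k \<le> n + card ?A" using V(2) \<open>f x \<in> M2\<close> .
      moreover have "?k \<le> m + card ?B" using U(2)[OF T(1) PB[OF T(1,2)], of x] x T by blast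
      moreover have "card ?A + card ?B = card (?A \<union> ?B) + card (?A \<inter> ?B)"
        by (rule card_Un_Int) auto
      moreover have "card (?A \<union> ?B) \<le> card {..<?k}" by (rule card_mono) auto
      moreover have "card (?A \<inter> ?B) \<le> card {c. c < ?k \<and> x \<in> W c}"
        by (rule card_mono) (use x T in \<open>auto simp: W_def\<close>)
      \<comment> \<open>The two colour sets have \<open>m + 1\<close> and \<open>n + 1\<close> elements at least, out of \<open>n + m + 1\<close>.\<close>
      ultimately show ?thesis by simp
    qed
    have "X.multicover r E (n + m) ?k M1 W"
      using bdd covers by (intro X.multicoverI) (auto dest: X.comp_bdd_subset)
    then show "\<exists>D\<ge>0. \<forall>A\<in>{M1}. \<exists>W. X.multicover r D (n + m) ?k A W"
      using E by blast
  qed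
qed


section \<open>Quasimorphisms\<close>

lemma left_invariantD:
  "left_invariant_proper_metric G d \<Longrightarrow> g \<in> carrier G \<Longrightarrow> x \<in> carrier G \<Longrightarrow> y \<in> carrier G \<Longrightarrow>
    d (g \<otimes>\<^bsub>G\<^esub> x) (g \<otimes>\<^bsub>G\<^esub> y) = d x y"
  by (simp add: left_invariant_proper_metric_def)

lemma defect_set_subset_carrier:
  assumes "group G" "group H" "quasimorphism G H f"
  shows "defect_set G H f \<subseteq> carrier H"
proof -
  interpret G: group G by fact
  interpret H: group H by fact
  show ?thesis using assms(3) unfolding quasimorphism_def defect_set_def by (auto simp: Pi_iff)
qed

lemma quasimorphism_multE:
  assumes "group G" "group H" and f: "quasimorphism G H f"
    and xy: "x \<in> carrier G" "y \<in> carrier G"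
  obtains \<delta> where "\<delta> \<in> defect_set G H f"
    "f (x \<otimes>\<^bsub>G\<^esub> y) = f x \<otimes>\<^bsub>H\<^esub> f y \<otimes>\<^bsub>H\<^esub> \<delta>"
proof
  interpret G: group G by fact
  interpret H: group H by fact
  let ?\<delta> = "inv\<^bsub>H\<^esub> (f y) \<otimes>\<^bsub>H\<^esub> inv\<^bsub>H\<^esub> (f x) \<otimes>\<^bsub>H\<^esub> f (x \<otimes>\<^bsub>G\<^esub> y)"
  have c: "f x \<in> carrier H" "f y \<in> carrier H" "f (x \<otimes>\<^bsub>G\<^esub> y) \<in> carrier H"
    using f xy unfolding quasimorphism_def by auto
  show "?\<delta> \<in> defect_set G H f" using xy unfolding defect_set_def by blast
  have "f x \<otimes>\<^bsub>H\<^esub> f y \<otimes>\<^bsub>H\<^esub> ?\<delta> = (f x \<otimes>\<^bsub>H\<^esub> f y) \<otimes>\<^bsub>H\<^esub> (inv\<^bsub>H\<^esub> (f x \<otimes>\<^bsub>H\<^esub> f y) \<otimes>\<^bsub>H\<^esub> f (x \<otimes>\<^bsub>G\<^esub> y))"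
    using c by (simp add: H.inv_mult_group)
  also have "\<dots> = f (x \<otimes>\<^bsub>G\<^esub> y)" using c by (simp flip: H.m_assoc)
  finally show "f (x \<otimes>\<^bsub>G\<^esub> y) = f x \<otimes>\<^bsub>H\<^esub> f y \<otimes>\<^bsub>H\<^esub> ?\<delta>" by simp
qed

text \<open>
  Both $f(x^{-1}y)$ and $f(1) = f(x^{-1}x)$ lie in $f(x^{-1})\,h\,D(f)$, where $h = f(x) = f(y)$.
  Eliminating $f(x^{-1})\,h$ gives $f(x^{-1}y) \in f(1)\,D(f)^{-1}D(f)$.
\<close>

lemma quasimorphism_fibre:
  assumes "group G" "group H" and f: "quasimorphism G H f"
    and xy: "x \<in> carrier G" "y \<in> carrier G" "f x = f y"
  shows "f (inv\<^bsub>G\<^esub> x \<otimes>\<^bsub>G\<^esub> y) \<in>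
    f \<one>\<^bsub>G\<^esub> <#\<^bsub>H\<^esub> (set_inv\<^bsub>H\<^esub> (defect_set G H f) <#>\<^bsub>H\<^esub> defect_set G H f)"
proof -
  interpret G: group G by fact
  interpret H: group H by fact
  have x': "inv\<^bsub>G\<^esub> x \<in> carrier G" using xy by simp
  let ?h = "f (inv\<^bsub>G\<^esub> x) \<otimes>\<^bsub>H\<^esub> f x"
  have h: "?h \<in> carrier H" using f xy x' unfolding quasimorphism_def by auto
  obtain \<delta> where \<delta>: "\<delta> \<in> defect_set G H f" "f (inv\<^bsub>G\<^esub> x \<otimes>\<^bsub>G\<^esub> y) = ?h \<otimes>\<^bsub>H\<^esub> \<delta>"
    using quasimorphism_multE[OF assms(1,2) f x' xy(2)] xy(3) by metis
  obtain \<epsilon> where \<epsilon>: "\<epsilon> \<in> defect_set G H f" "f \<one>\<^bsub>G\<^esub> = ?h \<otimes>\<^bsub>H\<^esub> \<epsilon>"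
    using quasimorphism_multE[OF assms(1,2) f x' xy(1)] xy(1) by (metis G.l_inv)
  have c: "\<delta> \<in> carrier H" "\<epsilon> \<in> carrier H"
    using defect_set_subset_carrier[OF assms(1-3)] \<delta> \<epsilon> by auto
  have "f \<one>\<^bsub>G\<^esub> \<otimes>\<^bsub>H\<^esub> (inv\<^bsub>H\<^esub> \<epsilon> \<otimes>\<^bsub>H\<^esub> \<delta>) = ?h \<otimes>\<^bsub>H\<^esub> (\<epsilon> \<otimes>\<^bsub>H\<^esub> inv\<^bsub>H\<^esub> \<epsilon>) \<otimes>\<^bsub>H\<^esub> \<delta>"
    unfolding \<epsilon>(2) using c h by (simp only: H.m_assoc H.m_closed H.inv_closed)
  also have "\<dots> = f (inv\<^bsub>G\<^esub> x \<otimes>\<^bsub>G\<^esub> y)" using c h \<delta>(2) by simp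
  finally show ?thesis
    using \<delta>(1) \<epsilon>(1) unfolding l_coset_def set_mult_def SET_INV_def by force
qed

lemma quasimorphism_bornologous:
  assumes "group G" "group H" and f: "quasimorphism G H f"
    and dG: "left_invariant_proper_metric G dG" and dH: "left_invariant_proper_metric H dH"
  shows "\<exists>R>0. \<forall>x\<in>carrier G. \<forall>y\<in>carrier G. dG x y < r \<longrightarrow> dH (f x) (f y) < R"
proof -
  interpret G: group G by fact
  interpret H: group H by fact
  let ?D = "defect_set G H f"
  define B where "B = {b \<in> carrier G. dG \<one>\<^bsub>G\<^esub> b \<le> r}"
  define R where "R = (\<Sum>(b, \<delta>)\<in>B \<times> ?D. \<bar>dH \<one>\<^bsub>H\<^esub> (f b \<otimes>\<^bsub>H\<^esub> \<delta>)\<bar>) + 1"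
  have fin: "finite (B \<times> ?D)"
    using left_invariant_proper_metric_finite_ball[OF dG, of "\<one>\<^bsub>G\<^esub>" r] f
    unfolding B_def quasimorphism_def by simp
  have "R > 0" unfolding R_def by (smt (verit) sum_nonneg abs_ge_zero case_prod_beta)
  moreover have "dH (f x) (f y) < R" if x: "x \<in> carrier G" and y: "y \<in> carrier G" and r: "dG x y < r" for x y
  proof -
    let ?b = "inv\<^bsub>G\<^esub> x \<otimes>\<^bsub>G\<^esub> y"
    have b: "?b \<in> carrier G" "x \<otimes>\<^bsub>G\<^esub> ?b = y" using x y by (simp_all flip: G.m_assoc)
    have "dG \<one>\<^bsub>G\<^esub> ?b = dG x y"
      using left_invariantD[OF dG x G.one_closed b(1)] b(2) x by simp
    then have "?b \<in> B" using b(1) r unfolding B_def by simp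
    obtain \<delta> where \<delta>: "\<delta> \<in> ?D" "f y = f x \<otimes>\<^bsub>H\<^esub> f ?b \<otimes>\<^bsub>H\<^esub> \<delta>"
      using quasimorphism_multE[OF assms(1,2) f x b(1)] b(2) by metis
    have c: "f x \<in> carrier H" "f ?b \<in> carrier H" "\<delta> \<in> carrier H"
      using f x b \<delta>(1) defect_set_subset_carrier[OF assms(1-3)] unfolding quasimorphism_def by auto
    have "dH (f x) (f y) = dH (f x \<otimes>\<^bsub>H\<^esub> \<one>\<^bsub>H\<^esub>) (f x \<otimes>\<^bsub>H\<^esub> (f ?b \<otimes>\<^bsub>H\<^esub> \<delta>))"
      using \<delta>(2) c by (simp add: H.m_assoc)
    also have "\<dots> = dH \<one>\<^bsub>H\<^esub> (f ?b \<otimes>\<^bsub>H\<^esub> \<delta>)"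
      using c by (intro left_invariantD[OF dH]) auto
    finally have "dH (f x) (f y) = dH \<one>\<^bsub>H\<^esub> (f ?b \<otimes>\<^bsub>H\<^esub> \<delta>)" .
    moreover have "(case (?b, \<delta>) of (b, \<delta>) \<Rightarrow> \<bar>dH \<one>\<^bsub>H\<^esub> (f b \<otimes>\<^bsub>H\<^esub> \<delta>)\<bar>)
        \<le> (\<Sum>(b, \<delta>)\<in>B \<times> ?D. \<bar>dH \<one>\<^bsub>H\<^esub> (f b \<otimes>\<^bsub>H\<^esub> \<delta>)\<bar>)"
      by (rule member_le_sum) (use \<open>?b \<in> B\<close> \<delta>(1) fin in auto)
    ultimately show ?thesis unfolding R_def by simp
  qed
  ultimately show ?thesis by blast
qed

text \<open>
  Fix $x$ with $f(x) \in B$. If also $f(y) \in B$, then $f(x)^{-1}f(y)$ has length at most $S$, so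
  $f(x^{-1}y)$ lies in a finite set $F$ that depends only on $S$. The fibre over each element of $F$
  lies in one left translate of $K$, hence the preimage of $B$ lies in a union of at most $|F|$ left
  translates. The number $N$ is independent of $B$.
\<close>

lemma quasimorphism_preimage_bounded:
  assumes "group G" "group H" and f: "quasimorphism G H f"
    and dH: "left_invariant_proper_metric H dH"
    and K: "K = f -` (f \<one>\<^bsub>G\<^esub> <#\<^bsub>H\<^esub> (set_inv\<^bsub>H\<^esub> (defect_set G H f) <#>\<^bsub>H\<^esub> defect_set G H f)) \<inter> carrier G"
  shows "\<exists>N::nat. \<forall>B. (\<forall>u\<in>B. \<forall>v\<in>B. dH u v \<le> S) \<longrightarrow>
    (\<exists>g. (\<forall>i. g i \<in> carrier G) \<and> f -` B \<inter> carrier G \<subseteq> (\<Union>i<N. (\<lambda>x. g i \<otimes>\<^bsub>G\<^esub> x) ` K))"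
proof -
  interpret G: group G by fact
  interpret H: group H by fact
  let ?D = "defect_set G H f"
  have DH: "?D \<subseteq> carrier H" using defect_set_subset_carrier[OF assms(1-3)] .
  define F where "F = (\<lambda>(t, \<delta>). t \<otimes>\<^bsub>H\<^esub> inv\<^bsub>H\<^esub> \<delta>) ` ({t \<in> carrier H. dH \<one>\<^bsub>H\<^esub> t \<le> S} \<times> ?D)"
  have "finite F"
    using left_invariant_proper_metric_finite_ball[OF dH, of "\<one>\<^bsub>H\<^esub>" S] f
    unfolding F_def quasimorphism_def by simp
  then obtain e :: "nat \<Rightarrow> 'c" where "bij_betw e {0..<card F} F"
    using ex_bij_betw_nat_finite by blast
  then have e: "e ` {..<card F} = F" by (simp add: bij_betw_def lessThan_atLeast0)
  \<comment> \<open>A representative of the fibre over \<open>h\<close>; the value on empty fibres only has to lie in \<open>G\<close>.\<close>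
  define z where "z h = (if h \<in> f ` carrier G then inv_into (carrier G) f h else \<one>\<^bsub>G\<^esub>)" for h
  have z: "z h \<in> carrier G" for h unfolding z_def by (simp add: inv_into_into)
  have fz: "f (z (f y)) = f y" if "y \<in> carrier G" for y
    unfolding z_def using that by (simp add: f_inv_into_f)
  have "\<exists>g. (\<forall>i. g i \<in> carrier G) \<and> f -` B \<inter> carrier G \<subseteq> (\<Union>i<card F. (\<lambda>x. g i \<otimes>\<^bsub>G\<^esub> x) ` K)"
    if B: "\<forall>u\<in>B. \<forall>v\<in>B. dH u v \<le> S" for B
  proof (cases "f -` B \<inter> carrier G = {}")
    case True
    then show ?thesis by (intro exI[of _ "\<lambda>_. \<one>\<^bsub>G\<^esub>"]) simp
  next
    case False
    then obtain x where x: "x \<in> carrier G" "f x \<in> B" by blast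
    show ?thesis
    proof (rule exI[of _ "\<lambda>i. x \<otimes>\<^bsub>G\<^esub> z (e i)"], intro conjI allI subsetI)
      show "x \<otimes>\<^bsub>G\<^esub> z (e i) \<in> carrier G" for i using x z by simp
      fix y assume "y \<in> f -` B \<inter> carrier G"
      then have y: "y \<in> carrier G" "f y \<in> B" by auto
      let ?w = "inv\<^bsub>G\<^esub> x \<otimes>\<^bsub>G\<^esub> y"
      have w: "?w \<in> carrier G" "x \<otimes>\<^bsub>G\<^esub> ?w = y" using x y by (simp_all flip: G.m_assoc)
      obtain \<delta> where \<delta>: "\<delta> \<in> ?D" "f y = f x \<otimes>\<^bsub>H\<^esub> f ?w \<otimes>\<^bsub>H\<^esub> \<delta>"
        using quasimorphism_multE[OF assms(1,2) f x(1) w(1)] w(2) by metis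
      have c: "f x \<in> carrier H" "f ?w \<in> carrier H" "\<delta> \<in> carrier H"
        using f x w \<delta>(1) DH unfolding quasimorphism_def by auto
      let ?t = "f ?w \<otimes>\<^bsub>H\<^esub> \<delta>"
      have "dH \<one>\<^bsub>H\<^esub> ?t = dH (f x \<otimes>\<^bsub>H\<^esub> \<one>\<^bsub>H\<^esub>) (f x \<otimes>\<^bsub>H\<^esub> ?t)"
        using c by (intro left_invariantD[OF dH, symmetric]) auto
      also have "\<dots> = dH (f x) (f y)" using \<delta>(2) c by (simp add: H.m_assoc)
      also have "\<dots> \<le> S" using B x(2) y(2) by blast
      finally have "(?t, \<delta>) \<in> {t \<in> carrier H. dH \<one>\<^bsub>H\<^esub> t \<le> S} \<times> ?D" using c \<delta>(1) by simp
      moreover have "f ?w = ?t \<otimes>\<^bsub>H\<^esub> inv\<^bsub>H\<^esub> \<delta>" using c by (simp add: H.m_assoc)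
      ultimately have "f ?w \<in> F" unfolding F_def by (intro image_eqI[of _ _ "(?t, \<delta>)"]) auto
      then obtain i where i: "i < card F" "e i = f ?w" using e by (metis imageE lessThan_iff)
      let ?z = "z (f ?w)"
      have "inv\<^bsub>G\<^esub> ?z \<otimes>\<^bsub>G\<^esub> ?w \<in> K"
        using quasimorphism_fibre[OF assms(1,2) f z w(1) fz[OF w(1)]] z w(1) unfolding K by simp
      moreover have "y = x \<otimes>\<^bsub>G\<^esub> ?z \<otimes>\<^bsub>G\<^esub> (inv\<^bsub>G\<^esub> ?z \<otimes>\<^bsub>G\<^esub> ?w)"
      proof -
        have "?z \<otimes>\<^bsub>G\<^esub> (inv\<^bsub>G\<^esub> ?z \<otimes>\<^bsub>G\<^esub> ?w) = ?w" using z w(1) by (simp flip: G.m_assoc)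
        then show ?thesis using x(1) z w G.m_assoc by simp
      qed
      ultimately show "y \<in> (\<Union>i<card F. (\<lambda>k. x \<otimes>\<^bsub>G\<^esub> z (e i) \<otimes>\<^bsub>G\<^esub> k) ` K)"
        using i by (intro UN_I[of i]) auto
    qed
  qed
  then show ?thesis by blast
qed

theorem corollary5p2:
  fixes G :: "('a, 'm) monoid_scheme" and H :: "('b, 'n) monoid_scheme" and f :: "'a \<Rightarrow> 'b"
  assumes "group G" and "countable (carrier G)"
    and "group H" and "countable (carrier H)"
    and "quasimorphism G H f"
  shows "group_asdim G (carrier G) \<le>
           group_asdim H (carrier H) +
           group_asdim G
             (f -` (f \<one>\<^bsub>G\<^esub> <#\<^bsub>H\<^esub> (set_inv\<^bsub>H\<^esub> (defect_set G H f) <#>\<^bsub>H\<^esub> defect_set G H f)) \<inter> carrier G)"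
proof -
  interpret G: group G by fact
  define K where "K = f -` (f \<one>\<^bsub>G\<^esub> <#\<^bsub>H\<^esub> (set_inv\<^bsub>H\<^esub> (defect_set G H f) <#>\<^bsub>H\<^esub> defect_set G H f)) \<inter> carrier G"
  have KG: "K \<subseteq> carrier G" unfolding K_def by blast
  obtain dG where dG: "left_invariant_proper_metric G dG"
    using ex_left_invariant_proper_metric assms(1,2) by blast
  obtain dH where dH: "left_invariant_proper_metric H dH"
    using ex_left_invariant_proper_metric assms(3,4) by blast
  interpret X: Metric_space "carrier G" dG
    using dG by (simp add: left_invariant_proper_metric_def)
  interpret Y: Metric_space "carrier H" dH
    using dH by (simp add: left_invariant_proper_metric_def)
  interpret S: Metric_space K dG
    using KG by (rule X.subspace)
  have "X.asdim \<le> Y.asdim + S.asdim"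
  proof (cases "Y.asdim = \<infinity> \<or> S.asdim = \<infinity>")
    case True
    then show ?thesis by auto
  next
    case False
    then obtain n m where n: "Y.asdim = enat n" and m: "S.asdim = enat m" by auto
    have "S.colorable {K} m (Suc m)"
      using S.asdim_finite_imp_asdim_le[OF m] by (simp add: S.asdim_le_iff_colorable)
    then have cK: "X.colorable {K} m (Suc m)" by (rule X.colorable_subspace[OF KG])
    \<comment> \<open>The left translates of \<open>K\<close>, uniformly of dimension at most \<open>m\<close>.\<close>
    define \<T> where "\<T> = {\<phi> ` A |\<phi> A. \<phi> \<in> {(\<lambda>x. g \<otimes>\<^bsub>G\<^esub> x) |g. g \<in> carrier G} \<and> A \<in> {K}}"
    have cT: "X.colorable \<T> m (Suc m)"
      unfolding \<T>_def
      by (rule X.colorable_isometric_images[OF cK]) (auto simp: left_invariantD[OF dG])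
    have preimages: "X.colorable {f -` B \<inter> carrier G |B. \<forall>u\<in>B. \<forall>v\<in>B. dH u v \<le> S} m (Suc m)" for S
    proof -
      obtain N :: nat where N: "\<forall>B. (\<forall>u\<in>B. \<forall>v\<in>B. dH u v \<le> S) \<longrightarrow>
          (\<exists>g. (\<forall>i. g i \<in> carrier G) \<and> f -` B \<inter> carrier G \<subseteq> (\<Union>i<N. (\<lambda>x. g i \<otimes>\<^bsub>G\<^esub> x) ` K))"
        using quasimorphism_preimage_bounded[OF assms(1,3,5) dH K_def, of S] ..
      show ?thesis
      proof (rule X.colorable_subsets[OF X.colorable_unions[OF cT, of N]])
        fix A assume "A \<in> {f -` B \<inter> carrier G |B. \<forall>u\<in>B. \<forall>v\<in>B. dH u v \<le> S}"
        then obtain B where A: "A = f -` B \<inter> carrier G" and B: "\<forall>u\<in>B. \<forall>v\<in>B. dH u v \<le> S" by blast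
        obtain g where g: "\<And>i. g i \<in> carrier G" "A \<subseteq> (\<Union>i<N. (\<lambda>x. g i \<otimes>\<^bsub>G\<^esub> x) ` K)"
          using N[THEN spec, THEN mp, OF B] A by blast
        have "(\<lambda>x. g i \<otimes>\<^bsub>G\<^esub> x) ` K \<in> \<T>" for i using g(1) unfolding \<T>_def by blast
        then show "\<exists>A'\<in>{\<Union>i<N. B i |B. \<forall>i<N. B i \<in> \<T>}. A \<subseteq> A'" using g(2) by blast
      qed
    qed
    have "f ` carrier G \<subseteq> carrier H" using assms(5) by (auto simp: quasimorphism_def)
    then have "X.asdim_le (n + m)"
      by (rule asdim_Hurewicz[OF X.Metric_space_axioms Y.Metric_space_axioms _
            quasimorphism_bornologous[OF assms(1,3,5) dG dH] Y.asdim_finite_imp_asdim_le[OF n] preimages])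
    then have "X.asdim \<le> enat (n + m)" unfolding X.asdim_def by (intro Inf_lower) blast
    then show ?thesis by (simp add: n m)
  qed
  then show ?thesis
    unfolding K_def[symmetric] group_asdim_eq[OF assms(1) dG subset_refl]
      group_asdim_eq[OF assms(3) dH subset_refl] group_asdim_eq[OF assms(1) dG KG] .
qed

end
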